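(* Fix $\ell\ge1$. For all $n\ge0$, the following three sets are equinumerous: (1) The set $S_1(n)$ of cylindric partitions of weight $n$ with profile $(2\ell+1,0)$. (2) The set $S_2(n)$ of colored partitions $\Lambda$ of weight $n$ with the following properties: - All colors are in the set $\{0,1,\dots,\ell\}$. - Any two parts of size $i$ that appear must have the same color. - Parts of size $1$ can only occur with color $0$. - For $1\le i<\ell$, parts of size $2i$ and $2i+1$ can only occur with colors in $\{0,1,\dots,i\}$. - Suppose $i<j$. If the parts $i_A$ and $j_B$ both appear in $\Lambda$, then both of the following inequalities are true: $$\left\lfloor\frac j2\right\rfloor-\left\lfloor\frac i2\right\rfloor\ge B-A,\qquad \left\lceil\frac j2\right\rceil-\left\lceil\frac i2\right\rceil\ge A-B.$$ (3) The set $S_3(n)$ of pairs $(\mu,\nu)$ such that the sum of the weights of $\mu$ and $\nu$ is $n$, where $\mu$ is an ordinary partition and $\nu$ is a colored $[1,0,\dots,0]$-admissible partition on $2\ell$ rows.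
   Context: Weight means the sum of all parts (of a partition, cylindric partition, or colored partition). Partitions are nonincreasing finite sequences of positive integers (possibly empty). Cylindric partitions: a (two-rowed) cylindric partition of profile $(c_1,c_2)$, $c_1,c_2\ge0$, is a pair of partitions $(\tau^{(1)},\tau^{(2)})$ such that for all $i\ge 1$, $\tau^{(1)}_i\ge\tau^{(2)}_{i+c_2}$ and $\tau^{(2)}_i\ge\tau^{(1)}_{i+c_1}$ (parts beyond the length of a partition are taken to be $0$). Colored partitions in $S_2(n)$: finite multisets of colored positive integers; $i_A$ denotes a part of size $i$ with color $A$. Repetitions are allowed. $[1,0,\dots,0]$-admissible partitions on $2\ell$ rows: consider an array with rows numbered $1,\dots,2\ell$ from top to bottom, where each odd-numbered row consists of the parts $1,3,5,\dots$ and each even-numbered row of the parts $2,4,6,\dots$; parts of equal size in different rows are distinct. A colored partition on $2\ell$ rows is a finite multiset of parts of this array. In each row place, at horizontal position $s$, the number of occurrences (frequency) of the part of size $s$ in that row. Additionally put an extra entry at position $-1$ in each odd row and at position $0$ in each even row; the extra entry at position $0$ of row $2\ell$ equals $1$ and all other extra entries equal $0$. A downward path is a choice of one entry in each row such that positions of entries in consecutive rows differ by exactly $1$. The colored partition is $[1,0,\dots,0]$-admissible if the sum of the entries along every downward path is at most $1$. *)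

theory Defs
  imports Complex_Main "HOL-Library.Multiset" "HOL-Library.Equipollence"
begin

definition is_partition :: "nat list \<Rightarrow> bool" where
  "is_partition xs \<longleftrightarrow> sorted_wrt (\<ge>) xs \<and> (\<forall>x\<in>set xs. x > 0)"

text \<open>Parts are numbered from 1, and are 0 beyond the length of the partition.\<close>
definition part :: "nat list \<Rightarrow> nat \<Rightarrow> nat" where
  "part xs i = (if 1 \<le> i \<and> i \<le> length xs then xs ! (i - 1) else 0)"

definition is_cylindric :: "nat \<Rightarrow> nat \<Rightarrow> nat list \<times> nat list \<Rightarrow> bool" where
  "is_cylindric c1 c2 \<tau> \<longleftrightarrow>
     is_partition (fst \<tau>) \<and> is_partition (snd \<tau>) \<and>
     (\<forall>i\<ge>1. part (fst \<tau>) i \<ge> part (snd \<tau>) (i + c2)) \<and>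
     (\<forall>i\<ge>1. part (snd \<tau>) i \<ge> part (fst \<tau>) (i + c1))"

definition S1 :: "nat \<Rightarrow> nat \<Rightarrow> (nat list \<times> nat list) set" where
  "S1 l n = {\<tau>. is_cylindric (2 * l + 1) 0 \<tau> \<and> sum_list (fst \<tau>) + sum_list (snd \<tau>) = n}"

text \<open>A colored part is a pair (size, color); for colored partitions on \<open>2l\<close> rows the
  color is the row number.\<close>
type_synonym colored_partition = "(nat \<times> nat) multiset"

definition colored_weight :: "colored_partition \<Rightarrow> nat" where
  "colored_weight \<Lambda> = (\<Sum>p\<in>#\<Lambda>. fst p)"

definition S2 :: "nat \<Rightarrow> nat \<Rightarrow> colored_partition set" where
  "S2 l n = {\<Lambda>. colored_weight \<Lambda> = n \<and>
     (\<forall>(i, A)\<in>#\<Lambda>. i > 0 \<and> A \<in> {0..l}) \<and>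
     (\<forall>i A B. (i, A) \<in># \<Lambda> \<longrightarrow> (i, B) \<in># \<Lambda> \<longrightarrow> A = B) \<and>
     (\<forall>A. (1, A) \<in># \<Lambda> \<longrightarrow> A = 0) \<and>
     (\<forall>i A. 1 \<le> i \<longrightarrow> i < l \<longrightarrow> (2 * i, A) \<in># \<Lambda> \<or> (2 * i + 1, A) \<in># \<Lambda> \<longrightarrow> A \<in> {0..i}) \<and>
     (\<forall>i j A B. i < j \<longrightarrow> (i, A) \<in># \<Lambda> \<longrightarrow> (j, B) \<in># \<Lambda> \<longrightarrow>
        \<lfloor>real j / 2\<rfloor> - \<lfloor>real i / 2\<rfloor> \<ge> int B - int A \<and>
        \<lceil>real j / 2\<rceil> - \<lceil>real i / 2\<rceil> \<ge> int A - int B)}"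

definition is_row_partition :: "nat \<Rightarrow> colored_partition \<Rightarrow> bool" where
  "is_row_partition l \<nu> \<longleftrightarrow>
     (\<forall>(s, r)\<in>#\<nu>. r \<in> {1..2 * l} \<and> s > 0 \<and> (even s \<longleftrightarrow> even r))"

text \<open>Horizontal positions occupied in row \<open>r\<close>, including that of the extra entry.\<close>
definition positions :: "nat \<Rightarrow> int set" where
  "positions r = (if odd r then {s. odd s \<and> s \<ge> -1} else {s. even s \<and> s \<ge> 0})"

text \<open>The entries at nonpositive positions are the extra entries; the one equal to 1, in the last
  row, is what makes \<open>admissible\<close> below stand for \<open>[1,0,\<dots>,0]\<close>-admissible. The value is only
  used for \<open>s \<in> positions r\<close>.\<close>
definition entry :: "nat \<Rightarrow> colored_partition \<Rightarrow> nat \<Rightarrow> int \<Rightarrow> nat" where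
  "entry l \<nu> r s =
     (if s > 0 then count \<nu> (nat s, r) else if r = 2 * l \<and> s = 0 then 1 else 0)"

text \<open>A path is given by the position chosen in each row; values of the function outside
  the rows \<open>1, \<dots>, 2l\<close> are irrelevant.\<close>
definition downward_path :: "nat \<Rightarrow> (nat \<Rightarrow> int) \<Rightarrow> bool" where
  "downward_path l p \<longleftrightarrow> (\<forall>r\<in>{1..2 * l}. p r \<in> positions r) \<and>
     (\<forall>r\<in>{1..<2 * l}. \<bar>p (r + 1) - p r\<bar> = 1)"

definition admissible :: "nat \<Rightarrow> colored_partition \<Rightarrow> bool" where
  "admissible l \<nu> \<longleftrightarrow> is_row_partition l \<nu> \<and>
     (\<forall>p. downward_path l p \<longrightarrow> (\<Sum>r = 1..2 * l. entry l \<nu> r (p r)) \<le> 1)"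

definition S3 :: "nat \<Rightarrow> nat \<Rightarrow> (nat list \<times> colored_partition) set" where
  "S3 l n = {(\<mu>, \<nu>). is_partition \<mu> \<and> admissible l \<nu> \<and>
     sum_list \<mu> + colored_weight \<nu> = n}"

end

theory Submission
  imports Defs
begin

text \<open>The layers \<open>(a, b)\<close> of a cylindric partition (the columns of its two rows) form a multichain
  of lattice points in the strip \<open>0 \<le> a - b \<le> 2 * l + 1\<close>. A part of size \<open>i\<close> and color \<open>A\<close> encodes
  the layer \<open>a = \<lceil>i / 2\<rceil> + A\<close>, \<open>b = \<lfloor>i / 2\<rfloor> - A\<close>, and the difference conditions say precisely that
  the layers are comparable.

  On the other side, admissibility means that the points \<open>((s - r) / 2 + l, (s + r) / 2 - l)\<close>
  given by the parts \<open>s\<close> in rows \<open>r\<close> are distinct, strictly increase in both coordinates and are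
  possible corners (north step followed by east step) of a lattice path in the strip at which the
  path can be flipped without leaving the strip.

  Every multichain lies on a unique path in the strip all of whose flippable corners belong to the
  multichain, and every admissible set of points is the set of flippable corners of a unique path.
  Since a path meets each weight \<open>a + b\<close> once, a multichain on it is a multiset of weights, in
  which the corners are only required to occur; removing one copy of each leaves an arbitrary
  partition.\<close>

subsection \<open>Lattice paths in a strip\<close>

text \<open>A lattice path of unit steps east and north is encoded by its ordinate \<open>b i\<close> after \<open>i\<close> steps;
  the strip is \<open>0 \<le> x - y \<le> D\<close>.\<close>

definition strip_path :: "nat \<Rightarrow> (nat \<Rightarrow> nat) \<Rightarrow> bool" where
  "strip_path D b \<longleftrightarrow>
     (\<forall>i. b i \<le> b (Suc i) \<and> b (Suc i) \<le> Suc (b i) \<and> 2 * b i \<le> i \<and> i \<le> 2 * b i + D)"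

text \<open>North-east turns that can be flipped to east-north turns without leaving the strip.\<close>

definition corners :: "nat \<Rightarrow> (nat \<Rightarrow> nat) \<Rightarrow> nat set" where
  "corners D b = {i. b (i - 1) < b i \<and> b (Suc i) = b i \<and> i + 2 \<le> 2 * b i + D}"

text \<open>A lattice point \<open>(x, y)\<close> is encoded as \<open>(x + y, y)\<close>.\<close>

definition strip_chain :: "nat \<Rightarrow> (nat \<times> nat) set \<Rightarrow> bool" where
  "strip_chain D M \<longleftrightarrow> finite M \<and> (\<forall>(i, c)\<in>M. 2 * c \<le> i \<and> i \<le> 2 * c + D) \<and>
     (\<forall>(i, c)\<in>M. \<forall>(j, d)\<in>M. i \<le> j \<longrightarrow> c \<le> d \<and> d + i \<le> c + j)"

definition passes_through :: "(nat \<Rightarrow> nat) \<Rightarrow> (nat \<times> nat) set \<Rightarrow> bool" where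
  "passes_through b M \<longleftrightarrow> (\<forall>(i, c)\<in>M. b i = c)"

text \<open>The pointwise maximum of all lower bounds on a strip path through \<open>M\<close>. The
  strip forces the ceiling of \<open>(i - D) / 2\<close>; a point \<open>(j, c)\<close> forces
  \<open>c\<close> for \<open>i \<ge> j\<close> and, as ordinates grow by at most 1 per step,
  \<open>c - (j - i)\<close> for \<open>i \<le> j\<close>. The minimum merges these two
  cases.\<close>

definition lowest_path :: "nat \<Rightarrow> (nat \<times> nat) set \<Rightarrow> nat \<Rightarrow> nat" where
  "lowest_path D M i = Max (insert ((i + 1 - D) div 2) ((\<lambda>(j, c). min c (i + c - j)) ` M))"

lemma strip_pathD:
  assumes "strip_path D b"
  shows "b i \<le> b (Suc i)" "b (Suc i) \<le> Suc (b i)" "2 * b i \<le> i" "i \<le> 2 * b i + D"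
  using assms by (auto simp: strip_path_def)

lemma strip_path_mono:
  assumes "strip_path D b" "i \<le> j"
  shows "b i \<le> b j"
  using lift_Suc_mono_le[of b i j] strip_pathD(1)[OF assms(1)] assms(2) by blast

lemma strip_path_lipschitz:
  assumes "strip_path D b" "i \<le> j"
  shows "b j + i \<le> b i + j"
  using assms(2)
proof (induction j rule: dec_induct)
  case (step n)
  then show ?case using strip_pathD(2)[OF assms(1), of n] by linarith
qed simp

section \<open>The lowest strip path through a chain\<close>

lemma lowest_path_le_iff:
  assumes "strip_chain D M"
  shows "lowest_path D M i \<le> k \<longleftrightarrow>
    (i + 1 - D) div 2 \<le> k \<and> (\<forall>(j, c)\<in>M. c \<le> k \<or> i + c - j \<le> k)"
  using assms by (auto simp: lowest_path_def strip_chain_def min_le_iff_disj)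

lemma lowest_path_ge:
  assumes "strip_chain D M"
  shows "(i + 1 - D) div 2 \<le> lowest_path D M i"
    and "(j, c) \<in> M \<Longrightarrow> c \<le> lowest_path D M i \<or> i + c - j \<le> lowest_path D M i"
  using lowest_path_le_iff[OF assms, of i "lowest_path D M i"] by auto

text \<open>Comparability of \<open>(i, c)\<close> with the other points keeps their bounds at
  \<open>i\<close> down to \<open>c\<close>, while its own bound there is exactly
  \<open>c\<close>.\<close>

lemma lowest_path_through:
  assumes M: "strip_chain D M"
  shows "passes_through (lowest_path D M) M"
  unfolding passes_through_def
proof clarify
  fix i c assume ic: "(i, c) \<in> M"
  have "(i + 1 - D) div 2 \<le> c" using M ic by (fastforce simp: strip_chain_def)
  moreover have "d \<le> c \<or> i + d - j \<le> c" if "(j, d) \<in> M" for j d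
    using M ic that unfolding strip_chain_def by (cases "i \<le> j") fastforce+
  ultimately have "lowest_path D M i \<le> c" using lowest_path_le_iff[OF M] by auto
  moreover have "c \<le> lowest_path D M i" using lowest_path_ge(2)[OF M ic, of i] by simp
  ultimately show "lowest_path D M i = c" by simp
qed

text \<open>Each bound grows by 0 or 1 per step, and a maximum inherits this. It respects the
  diagonal because every point of \<open>M\<close> does.\<close>

lemma strip_path_lowest_path:
  assumes M: "strip_chain D M" and D: "D \<ge> 1"
  shows "strip_path D (lowest_path D M)"
  unfolding strip_path_def
proof (intro allI conjI)
  fix i
  let ?b = "lowest_path D M"
  have "c \<le> ?b (Suc i) \<or> i + c - j \<le> ?b (Suc i)" if "(j, c) \<in> M" for j c
    using lowest_path_ge(2)[OF M that, of "Suc i"] by linarith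
  moreover have "(i + 1 - D) div 2 \<le> ?b (Suc i)"
    using lowest_path_ge(1)[OF M, of "Suc i"] by linarith
  ultimately show "?b i \<le> ?b (Suc i)" using lowest_path_le_iff[OF M] by blast
  have "c \<le> Suc (?b i) \<or> Suc i + c - j \<le> Suc (?b i)" if "(j, c) \<in> M" for j c
    using lowest_path_ge(2)[OF M that, of i] by linarith
  moreover have "(Suc i + 1 - D) div 2 \<le> Suc (?b i)"
    using lowest_path_ge(1)[OF M, of i] by linarith
  ultimately show "?b (Suc i) \<le> Suc (?b i)" using lowest_path_le_iff[OF M] by blast
  have "c \<le> i div 2 \<or> i + c - j \<le> i div 2" if "(j, c) \<in> M" for j c
  proof -
    have "2 * c \<le> j" using M that by (auto simp: strip_chain_def)
    then show ?thesis by linarith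
  qed
  \<comment> \<open>For \<open>D = 0\<close> and odd \<open>i\<close> the left side would be
    larger.\<close>
  moreover have "(i + 1 - D) div 2 \<le> i div 2" using D by linarith
  ultimately have "?b i \<le> i div 2" using lowest_path_le_iff[OF M] by blast
  then show "2 * ?b i \<le> i" by simp
  show "i \<le> 2 * ?b i + D" using lowest_path_ge(1)[OF M, of i] by linarith
qed

lemma lowest_path_le:
  assumes M: "strip_chain D M" and b: "strip_path D b" "passes_through b M"
  shows "lowest_path D M i \<le> b i"
  unfolding lowest_path_le_iff[OF M]
proof (intro conjI, goal_cases)
  case 1
  show ?case using strip_pathD(4)[OF b(1), of i] by linarith
next
  case 2
  show ?case
  proof clarify
    fix j c assume jc: "(j, c) \<in> M" "\<not> i + c - j \<le> b i"
    then have "b j = c" using b(2) by (auto simp: passes_through_def)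
    then show "c \<le> b i"
      using jc strip_path_mono[OF b(1), of j i] strip_path_lipschitz[OF b(1), of i j]
      by (cases "i \<le> j") auto
  qed
qed

text \<open>A corner off \<open>M\<close> could be flipped to east-north, which lowers the path at
  that corner only and keeps it in the strip and through \<open>M\<close>, against
  minimality.\<close>

lemma corners_lowest_path:
  assumes M: "strip_chain D M" and D: "D \<ge> 1"
  shows "corners D (lowest_path D M) \<subseteq> fst ` M"
proof (rule subsetI, rule ccontr)
  fix i assume i: "i \<in> corners D (lowest_path D M)" and nM: "i \<notin> fst ` M"
  let ?b = "lowest_path D M"
  define c where "c = ?b(i := ?b i - 1)"
  note P = strip_pathD[OF strip_path_lowest_path[OF M D]]
  have i': "?b (i - 1) < ?b i" "?b (Suc i) = ?b i" "i + 2 \<le> 2 * ?b i + D"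
    using i by (auto simp: corners_def)
  then have "i > 0" by (cases i) auto
  have "strip_path D c"
    unfolding strip_path_def
  proof (intro allI conjI)
    fix j
    show "c j \<le> c (Suc j)" using P(1)[of j] i' by (auto simp: c_def)
    show "c (Suc j) \<le> Suc (c j)" using P(2)[of j] i' by (auto simp: c_def)
    show "2 * c j \<le> j" using P(3)[of j] by (auto simp: c_def)
    show "j \<le> 2 * c j + D" using P(4)[of j] i' by (auto simp: c_def)
  qed
  moreover have "passes_through c M"
    using lowest_path_through[OF M] nM by (force simp: passes_through_def c_def)
  ultimately have "?b i \<le> c i" by (rule lowest_path_le[OF M])
  then show False using i' by (simp add: c_def)
qed

text \<open>Once the upper of two distinct such paths has left the lower one by a north step, each
  further turn would be a flippable corner, so it would go north forever.\<close>

lemma strip_path_le_if_agree: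
  assumes b: "strip_path D b" and c: "strip_path D c"
    and W: "corners D b \<subseteq> W" "\<And>i. i \<in> W \<Longrightarrow> b i = c i"
  shows "b i \<le> c i"
proof (rule ccontr)
  assume "\<not> b i \<le> c i"
  then have ex: "c i < b i" by simp
  define j where "j = (LEAST j. c j < b j)"
  have j: "c j < b j" unfolding j_def using ex by (rule LeastI)
  have "j \<noteq> 0" using j strip_pathD(3)[OF b, of 0] by (cases j) auto
  then have j1: "b (j - 1) \<le> c (j - 1)"
    using not_less_Least[of "j - 1" "\<lambda>j. c j < b j"] by (auto simp: j_def)
  have "c (j - 1) \<le> c j" using strip_pathD(1)[OF c, of "j - 1"] \<open>j \<noteq> 0\<close> by simp
  \<comment> \<open>The last conjunct records that \<open>b\<close> enters \<open>j + k\<close> by a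
    north step, so that an east step out of it would be a turn.\<close>
  have *: "b (j + k) = b j + k \<and> c (j + k) < b (j + k) \<and> b (j + k - 1) < b (j + k)" for k
  proof (induction k)
    case 0
    then show ?case using j j1 \<open>c (j - 1) \<le> c j\<close> by simp
  next
    case (Suc k)
    then have "j + k \<notin> corners D b" using W by (metis less_irrefl subsetD)
    \<comment> \<open>The strictly lower path \<open>c\<close> is still in the strip, which leaves
      \<open>b\<close> the room for a flip.\<close>
    moreover have "j + k + 2 \<le> 2 * b (j + k) + D"
      using Suc strip_pathD(4)[OF c, of "j + k"] by linarith
    ultimately have "b (Suc (j + k)) \<noteq> b (j + k)" using Suc by (auto simp: corners_def)
    then have "b (Suc (j + k)) = Suc (b (j + k))"
      using strip_pathD(1,2)[OF b, of "j + k"] by linarith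
    then show ?case using Suc strip_pathD(2)[OF c, of "j + k"] by auto
  qed
  \<comment> \<open>After \<open>j + 1\<close> north steps the ordinate exceeds half of the index
    \<open>2 * j + 1\<close>: the path has crossed the diagonal.\<close>
  show False using *[of "Suc j"] strip_pathD(3)[OF b, of "j + Suc j"] by linarith
qed

text \<open>Yields injectivity of both encodings below, where \<open>W\<close> is the set of marked
  weights or the common set of corners.\<close>

lemma strip_path_eq_if_agree:
  assumes "strip_path D b" "strip_path D c" "corners D b \<subseteq> W" "corners D c \<subseteq> W"
    and "\<And>i. i \<in> W \<Longrightarrow> b i = c i"
  shows "b = c"
  using strip_path_le_if_agree[of D b c W] strip_path_le_if_agree[of D c b W] assms
  by (intro ext antisym) auto

text \<open>The path leaves the earlier corner by an east step and enters the later one by a north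
  step, so abscissa and ordinate both grow strictly.\<close>

lemma corners_less:
  assumes b: "strip_path D b" and ij: "i \<in> corners D b" "j \<in> corners D b" "i < j"
  shows "b i < b j" "b j + i < b i + j"
proof -
  have "b i \<le> b (j - 1)" using strip_path_mono[OF b] ij by simp
  then show "b i < b j" using ij by (simp add: corners_def)
  have "b j + Suc i \<le> b (Suc i) + j" using strip_path_lipschitz[OF b, of "Suc i" j] ij by simp
  then show "b j + i < b i + j" using ij by (simp add: corners_def)
qed

text \<open>By strictness the points of \<open>M\<close> force at most \<open>c - 1\<close> just
  before \<open>i\<close> and at most \<open>c\<close> just after it, and \<open>flip\<close> gives
  the same for the bound from the strip. The lowest path therefore turns at every point of
  \<open>M\<close>.\<close>

lemma corners_lowest_path_eq:
  assumes M: "strip_chain D M" and D: "D \<ge> 1"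
    and flip: "\<And>i c. (i, c) \<in> M \<Longrightarrow> 1 \<le> c \<and> i + 2 \<le> 2 * c + D"
    and strict: "\<And>i c j d. (i, c) \<in> M \<Longrightarrow> (j, d) \<in> M \<Longrightarrow> i < j \<Longrightarrow> c < d \<and> d + i < c + j"
  shows "corners D (lowest_path D M) = fst ` M"
proof (intro antisym corners_lowest_path[OF M D] subsetI)
  fix i assume "i \<in> fst ` M"
  then obtain c where ic: "(i, c) \<in> M" by auto
  let ?b = "lowest_path D M"
  have bi: "?b i = c" using lowest_path_through[OF M] ic by (auto simp: passes_through_def)
  have cmp: "(j < i \<and> d < c) \<or> (j = i \<and> d = c) \<or> (i < j \<and> d + i < c + j)" if "(j, d) \<in> M" for j d
    using strict[OF ic that] strict[OF that ic] that lowest_path_through[OF M] bi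
    by (cases i j rule: linorder_cases) (auto simp: passes_through_def)
  have f: "1 \<le> c" "i + 2 \<le> 2 * c + D" "2 * c \<le> i"
    using flip[OF ic] M ic by (auto simp: strip_chain_def)
  have "d \<le> c - 1 \<or> i - 1 + d - j \<le> c - 1" if "(j, d) \<in> M" for j d
    using cmp[OF that] f by linarith
  then have "?b (i - 1) \<le> c - 1" unfolding lowest_path_le_iff[OF M] using f by auto
  moreover have "d \<le> c \<or> Suc i + d - j \<le> c" if "(j, d) \<in> M" for j d
    using cmp[OF that] f by linarith
  then have "?b (Suc i) \<le> c" unfolding lowest_path_le_iff[OF M] using f by auto
  ultimately show "i \<in> corners D ?b"
    using bi f strip_pathD(1)[OF strip_path_lowest_path[OF M D], of i] by (auto simp: corners_def)
qed

text \<open>The common target for \<open>S2\<close> and \<open>S3\<close>: \<open>m\<close> lists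
  the weights of the marked points of \<open>b\<close> with multiplicity.\<close>

definition marked_paths :: "nat \<Rightarrow> nat \<Rightarrow> ((nat \<Rightarrow> nat) \<times> nat multiset) set" where
  "marked_paths D n =
     {(b, m). strip_path D b \<and> 0 \<notin># m \<and> corners D b \<subseteq> set_mset m \<and> sum_mset m = n}"

subsection \<open>Colored partitions as marked paths\<close>

lemma floor_half: "\<lfloor>real j / 2\<rfloor> = int (j div 2)"
  by linarith

lemma ceiling_half: "\<lceil>real j / 2\<rceil> = int ((j + 1) div 2)"
  by linarith

lemma ceiling_half_nat: "(k + 1) div 2 = k - k div 2" for k :: nat
  by linarith

text \<open>The color restrictions combine to \<open>A \<le> l\<close> and
  \<open>A \<le> i div 2\<close>: size 1 and sizes with half below \<open>l\<close> are restricted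
  explicitly, and beyond that \<open>l\<close> is the smaller bound. Uniqueness of the color of a
  size is the case \<open>i = j\<close> of the two inequalities.\<close>

lemma S2_iff:
  "\<Lambda> \<in> S2 l n \<longleftrightarrow> colored_weight \<Lambda> = n \<and>
     (\<forall>(i, A)\<in>#\<Lambda>. i > 0 \<and> A \<le> l \<and> A \<le> i div 2) \<and>
     (\<forall>(i, A)\<in>#\<Lambda>. \<forall>(j, B)\<in>#\<Lambda>. i \<le> j \<longrightarrow>
        i div 2 + B \<le> j div 2 + A \<and> (i + 1) div 2 + A \<le> (j + 1) div 2 + B)"
  (is "?L \<longleftrightarrow> ?W \<and> ?C \<and> ?D")
proof
  assume ?L
  note L = \<open>?L\<close>[unfolded S2_def mem_Collect_eq]
  note pos = L[THEN conjunct2, THEN conjunct1]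
    and same = L[THEN conjunct2, THEN conjunct2, THEN conjunct1]
    and one = L[THEN conjunct2, THEN conjunct2, THEN conjunct2, THEN conjunct1]
    and small = L[THEN conjunct2, THEN conjunct2, THEN conjunct2, THEN conjunct2, THEN conjunct1]
    and cmp = L[THEN conjunct2, THEN conjunct2, THEN conjunct2, THEN conjunct2, THEN conjunct2]
  have "i > 0 \<and> A \<le> l \<and> A \<le> i div 2" if iA: "(i, A) \<in># \<Lambda>" for i A
  proof -
    have 1: "i > 0" "A \<le> l" using pos iA by auto
    have 2: "i = 1 \<Longrightarrow> A = 0" using one iA by blast
    have "A \<le> i div 2" if "1 \<le> i div 2" "i div 2 < l"
    proof -
      have "i = 2 * (i div 2) \<or> i = 2 * (i div 2) + 1" by linarith
      then have "(2 * (i div 2), A) \<in># \<Lambda> \<or> (2 * (i div 2) + 1, A) \<in># \<Lambda>" using iA by metis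
      then have "A \<in> {0..i div 2}" using small that by blast
      then show ?thesis by simp
    qed
    then show ?thesis using 1 2 by linarith
  qed
  then have ?C by blast
  moreover have "i div 2 + B \<le> j div 2 + A \<and> (i + 1) div 2 + A \<le> (j + 1) div 2 + B"
    if iA: "(i, A) \<in># \<Lambda>" "(j, B) \<in># \<Lambda>" "i \<le> j" for i j A B
  proof (cases "i = j")
    case True
    then have "A = B" using same iA by blast
    then show ?thesis using True by simp
  next
    case False
    then have "i < j" using iA(3) by simp
    then have "\<lfloor>real j / 2\<rfloor> - \<lfloor>real i / 2\<rfloor> \<ge> int B - int A \<and>
      \<lceil>real j / 2\<rceil> - \<lceil>real i / 2\<rceil> \<ge> int A - int B"
      using cmp iA(1,2) by blast
    then show ?thesis unfolding floor_half ceiling_half by linarith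
  qed
  then have ?D by blast
  ultimately show "?W \<and> ?C \<and> ?D" using L by blast
next
  assume R: "?W \<and> ?C \<and> ?D"
  then have cmp: "i div 2 + B \<le> j div 2 + A \<and> (i + 1) div 2 + A \<le> (j + 1) div 2 + B"
    if "(i, A) \<in># \<Lambda>" "(j, B) \<in># \<Lambda>" "i \<le> j" for i A j B using that by blast
  have bd: "i > 0 \<and> A \<le> l \<and> A \<le> i div 2" if "(i, A) \<in># \<Lambda>" for i A using R that by blast
  show ?L
    unfolding S2_def mem_Collect_eq
  proof (intro conjI allI impI)
    show ?W using R by blast
    show "\<forall>(i, A)\<in>#\<Lambda>. i > 0 \<and> A \<in> {0..l}" using bd by auto
    show "A = B" if "(i, A) \<in># \<Lambda>" "(i, B) \<in># \<Lambda>" for i A B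
      using cmp[OF that] cmp[OF that(2,1)] by simp
    show "A = 0" if "(1, A) \<in># \<Lambda>" for A using bd[OF that] by simp
    show "A \<in> {0..i}" if "(2 * i, A) \<in># \<Lambda> \<or> (2 * i + 1, A) \<in># \<Lambda>" for i A
      using that bd[of "2 * i" A] bd[of "2 * i + 1" A] by auto
    fix i j A B assume *: "i < j" "(i, A) \<in># \<Lambda>" "(j, B) \<in># \<Lambda>"
    show "\<lfloor>real j / 2\<rfloor> - \<lfloor>real i / 2\<rfloor> \<ge> int B - int A"
      using cmp[OF *(2,3)] *(1) unfolding floor_half by linarith
    show "\<lceil>real j / 2\<rceil> - \<lceil>real i / 2\<rceil> \<ge> int A - int B"
      using cmp[OF *(2,3)] *(1) unfolding ceiling_half by linarith
  qed
qed

text \<open>The marked point of weight \<open>i\<close> has ordinate \<open>b i\<close>, hence color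
  \<open>i div 2 - b i\<close>. Conversely, a colored partition is marked on the lowest path through
  its layers, whose corners all lie among them.\<close>

lemma S2_approx_marked_paths: "S2 l n \<approx> marked_paths (2 * l + 1) n"
proof -
  \<comment> \<open>For an ordinate \<open>c\<close>, the color bound
    \<open>i div 2 - c \<le> l\<close> is equivalent to
    \<open>i \<le> 2 * c + (2 * l + 1)\<close>.\<close>
  let ?D = "2 * l + 1"
  define g where "g = (\<lambda>(b :: nat \<Rightarrow> nat, m). image_mset (\<lambda>i. (i, i div 2 - b i)) m)"
  have fst_g: "image_mset fst (g (b, m)) = m" for b m
    by (simp add: g_def image_mset.compositionality comp_def)
  have "bij_betw g (marked_paths ?D n) (S2 l n)"
    unfolding bij_betw_def
  proof (intro conjI antisym subsetI)
    show "inj_on g (marked_paths ?D n)"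
    proof (rule inj_onI)
      fix x y assume xy: "x \<in> marked_paths ?D n" "y \<in> marked_paths ?D n" "g x = g y"
      obtain b m c m' where eq: "x = (b, m)" "y = (c, m')" by fastforce
      have m: "m' = m" using fst_g xy(3) eq by metis
      have P: "strip_path ?D b" "strip_path ?D c" "corners ?D b \<subseteq> set_mset m" "corners ?D c \<subseteq> set_mset m"
        using xy eq m by (auto simp: marked_paths_def)
      have "b i = c i" if "i \<in># m" for i
      proof -
        have "(i, i div 2 - b i) \<in># g y"
          unfolding xy(3)[symmetric] using that by (auto simp: eq g_def)
        then have "i div 2 - b i = i div 2 - c i" by (auto simp: eq g_def)
        \<comment> \<open>Both ordinates are at most \<open>i div 2\<close>, so the truncated
          differences determine them.\<close>
        then show ?thesis using strip_pathD(3)[OF P(1), of i] strip_pathD(3)[OF P(2), of i] by linarith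
      qed
      then show "x = y" using strip_path_eq_if_agree[OF P] eq m by simp
    qed
  next
    fix \<Lambda> assume "\<Lambda> \<in> g ` marked_paths ?D n"
    then obtain b m where \<Lambda>: "\<Lambda> = g (b, m)" and bm: "(b, m) \<in> marked_paths ?D n" by auto
    have b: "strip_path ?D b" using bm by (auto simp: marked_paths_def)
    note P = strip_pathD(3,4)[OF b]
    have "colored_weight \<Lambda> = n"
      using bm fst_g[of b m] by (simp add: \<Lambda> colored_weight_def marked_paths_def)
    moreover have "\<forall>(i, A)\<in>#\<Lambda>. i > 0 \<and> A \<le> l \<and> A \<le> i div 2"
    proof clarify
      fix i A assume "(i, A) \<in># \<Lambda>"
      then have "i \<in># m" "A = i div 2 - b i" by (auto simp: \<Lambda> g_def)
      moreover from this have "i \<noteq> 0" using bm by (cases "i = 0") (auto simp: marked_paths_def)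
      ultimately show "i > 0 \<and> A \<le> l \<and> A \<le> i div 2" using P[of i] by linarith
    qed
    moreover have "\<forall>(i, A)\<in>#\<Lambda>. \<forall>(j, B)\<in>#\<Lambda>. i \<le> j \<longrightarrow>
        i div 2 + B \<le> j div 2 + A \<and> (i + 1) div 2 + A \<le> (j + 1) div 2 + B"
    proof clarify
      fix i A j B assume *: "(i, A) \<in># \<Lambda>" "(j, B) \<in># \<Lambda>" "i \<le> j"
      then have "A = i div 2 - b i" "B = j div 2 - b j" by (auto simp: \<Lambda> g_def)
      then show "i div 2 + B \<le> j div 2 + A \<and> (i + 1) div 2 + A \<le> (j + 1) div 2 + B"
        using P(1)[of i] P(1)[of j] strip_path_mono[OF b *(3)] strip_path_lipschitz[OF b *(3)]
        unfolding ceiling_half_nat by linarith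
    qed
    ultimately show "\<Lambda> \<in> S2 l n" unfolding S2_iff by blast
  next
    fix \<Lambda> assume "\<Lambda> \<in> S2 l n"
    then have \<Lambda>: "colored_weight \<Lambda> = n"
      "\<And>i A. (i, A) \<in># \<Lambda> \<Longrightarrow> i > 0 \<and> A \<le> l \<and> A \<le> i div 2"
      "\<And>i A j B. (i, A) \<in># \<Lambda> \<Longrightarrow> (j, B) \<in># \<Lambda> \<Longrightarrow> i \<le> j \<Longrightarrow>
        i div 2 + B \<le> j div 2 + A \<and> (i + 1) div 2 + A \<le> (j + 1) div 2 + B"
      unfolding S2_iff by blast+
    define M where "M = (\<lambda>(i, A). (i, i div 2 - A)) ` set_mset \<Lambda>"
    define b where "b = lowest_path ?D M"
    define m where "m = image_mset fst \<Lambda>"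
    have M: "strip_chain ?D M"
      unfolding strip_chain_def
    proof (intro conjI)
      show "finite M" by (simp add: M_def)
      show "\<forall>(i, c)\<in>M. 2 * c \<le> i \<and> i \<le> 2 * c + ?D"
      proof clarify
        fix i c assume "(i, c) \<in> M"
        then obtain A where "(i, A) \<in># \<Lambda>" "c = i div 2 - A" by (auto simp: M_def)
        then show "2 * c \<le> i \<and> i \<le> 2 * c + ?D" using \<Lambda>(2)[of i A] by linarith
      qed
      show "\<forall>(i, c)\<in>M. \<forall>(j, d)\<in>M. i \<le> j \<longrightarrow> c \<le> d \<and> d + i \<le> c + j"
      proof clarify
        fix i c j d assume *: "(i, c) \<in> M" "(j, d) \<in> M" "i \<le> j"
        then obtain A B where "(i, A) \<in># \<Lambda>" "c = i div 2 - A" "(j, B) \<in># \<Lambda>" "d = j div 2 - B"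
          by (auto simp: M_def)
        then show "c \<le> d \<and> d + i \<le> c + j"
          using \<Lambda>(2)[of i A] \<Lambda>(2)[of j B] \<Lambda>(3)[of i A j B] *(3)
          unfolding ceiling_half_nat by linarith
      qed
    qed
    have "(b, m) \<in> marked_paths ?D n"
      unfolding marked_paths_def
    proof (clarsimp, intro conjI)
      show "strip_path (Suc (2 * l)) b" using strip_path_lowest_path[OF M] by (simp add: b_def)
      show "0 \<notin># m" using \<Lambda>(2) by (fastforce simp: m_def)
      show "corners (Suc (2 * l)) b \<subseteq> set_mset m"
        using corners_lowest_path[OF M] by (simp add: b_def m_def M_def image_image case_prod_beta)
      show "sum_mset m = n" using \<Lambda>(1) by (simp add: m_def colored_weight_def)
    qed
    moreover have "g (b, m) = \<Lambda>"
    proof -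
      have "(fst p, fst p div 2 - b (fst p)) = p" if "p \<in># \<Lambda>" for p
      proof -
        obtain i A where p: "p = (i, A)" by fastforce
        have "(i, i div 2 - A) \<in> M" using that p by (force simp: M_def)
        then have "b i = i div 2 - A"
          using lowest_path_through[OF M] by (auto simp: b_def passes_through_def)
        then show ?thesis using \<Lambda>(2)[of i A] that p by simp
      qed
      then have "image_mset (\<lambda>p. (fst p, fst p div 2 - b (fst p))) \<Lambda> = image_mset (\<lambda>p. p) \<Lambda>"
        by (intro image_mset_cong) auto
      then show ?thesis by (simp add: g_def m_def image_mset.compositionality comp_def)
    qed
    ultimately show "\<Lambda> \<in> g ` marked_paths ?D n" by (metis imageI)
  qed
  then show ?thesis using eqpoll_def eqpoll_sym by blast
qed

subsection \<open>Admissible partitions as sets of corners\<close>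

lemma downward_path_dist:
  assumes p: "downward_path l p" and r: "1 \<le> r" "r \<le> r'" "r' \<le> 2 * l"
  shows "\<bar>p r' - p r\<bar> \<le> int r' - int r"
  using r(2,3)
proof (induction r' rule: dec_induct)
  case (step k)
  then have "\<bar>p (k + 1) - p k\<bar> = 1" using p r(1) unfolding downward_path_def by auto
  then show ?case using step by auto
qed simp

text \<open>The path is the maximum of two tents, peaking at \<open>s\<close> in row
  \<open>r\<close> and at \<open>s'\<close> in row \<open>r'\<close>, and the zigzag through the
  extra positions -1 and 0. All three change by at most 1 per row and have the parity of the row, so
  the maximum changes by exactly 1; \<open>d\<close> keeps either tent from exceeding the peak of
  the other.\<close>

lemma downward_path_through:
  assumes "0 \<le> s" "0 \<le> s'" "even s \<longleftrightarrow> even r" "even s' \<longleftrightarrow> even r'"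
    and d: "\<bar>s - s'\<bar> \<le> \<bar>int r - int r'\<bar>"
  obtains p where "downward_path l p" "p r = s" "p r' = s'"
proof -
  define p where
    "p k = max (max (s - \<bar>int k - int r\<bar>) (s' - \<bar>int k - int r'\<bar>)) (- int (k mod 2))" for k
  have par: "even (a - \<bar>b\<bar>) \<longleftrightarrow> even (a - b)" for a b :: int
    by (cases "b \<ge> 0") auto
  have "even (s - \<bar>int k - int r\<bar>) \<longleftrightarrow> even k" "even (s' - \<bar>int k - int r'\<bar>) \<longleftrightarrow> even k"
    "even (- int (k mod 2)) \<longleftrightarrow> even k" for k
    unfolding par using assms(3,4) by (auto simp: even_mod_2_iff)
  then have ev: "even (p k) \<longleftrightarrow> even k" for k
    unfolding p_def by (auto simp: max_def)
  have max_le: "\<bar>max a b - max a' b'\<bar> \<le> 1" if "\<bar>a - a'\<bar> \<le> 1" "\<bar>b - b'\<bar> \<le> 1" for a a' b b' :: int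
    using that by linarith
  have "\<bar>- int ((k + 1) mod 2) - - int (k mod 2)\<bar> \<le> 1" for k by (cases "even k") simp_all
  then have le: "\<bar>p (k + 1) - p k\<bar> \<le> 1" for k
    unfolding p_def by (intro max_le) auto
  have ne: "p (k + 1) \<noteq> p k" for k using ev[of k] ev[of "k + 1"] by auto
  have step: "\<bar>p (k + 1) - p k\<bar> = 1" for k
    using le[of k] ne[of k] by linarith
  have "p k \<in> positions k" for k
  proof (cases "odd k")
    case True
    then have "p k \<ge> -1" unfolding p_def by (simp add: odd_iff_mod_2_eq_one)
    then show ?thesis using True ev[of k] by (simp add: positions_def)
  next
    case False
    then have "p k \<ge> 0" unfolding p_def by (simp add: even_iff_mod_2_eq_zero)
    then show ?thesis using False ev[of k] by (simp add: positions_def)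
  qed
  then have "downward_path l p" using step by (simp add: downward_path_def)
  moreover have "p r = s" "p r' = s'" using assms(1,2) d unfolding p_def by linarith+
  ultimately show thesis using that by blast
qed

text \<open>The last clause for an ordinary part and the extra entry 1 at position 0 of row \<open>2 * l\<close> is
  the inequality \<open>2 * l < r + s\<close>.\<close>

lemma admissible_iff:
  "admissible l \<nu> \<longleftrightarrow> is_row_partition l \<nu> \<and> (\<forall>x. count \<nu> x \<le> 1) \<and>
     (\<forall>(s, r)\<in>#\<nu>. 2 * l < r + s) \<and>
     (\<forall>(s, r)\<in>#\<nu>. \<forall>(s', r')\<in>#\<nu>. r \<noteq> r' \<longrightarrow> \<bar>int r - int r'\<bar> < \<bar>int s - int s'\<bar>)"
  (is "_ \<longleftrightarrow> ?R \<and> ?C \<and> ?E \<and> ?P")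
proof (cases ?R)
  case R: True
  have row: "1 \<le> r" "r \<le> 2 * l" "s > 0" "even s \<longleftrightarrow> even r" if "(s, r) \<in># \<nu>" for s r
  proof -
    have "r \<in> {1..2 * l} \<and> s > 0 \<and> (even s \<longleftrightarrow> even r)"
      using R that unfolding is_row_partition_def by blast
    then show "1 \<le> r" "r \<le> 2 * l" "s > 0" "even s \<longleftrightarrow> even r" by auto
  qed
  have entry: "entry l \<nu> r (int s) = count \<nu> (s, r)" if "(s, r) \<in># \<nu>" for s r
    using row[OF that] by (simp add: entry_def)
  show ?thesis
  proof
    assume adm: "admissible l \<nu>"
    \<comment> \<open>Entries this close lie on a common downward path, whose sum dominates
      theirs.\<close>
    have two: "entry l \<nu> r s + entry l \<nu> r' s' \<le> 1"
      if h: "0 \<le> s" "0 \<le> s'" "even s \<longleftrightarrow> even r" "even s' \<longleftrightarrow> even r'" "r \<noteq> r'"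
        "r \<in> {1..2 * l}" "r' \<in> {1..2 * l}" "\<bar>s - s'\<bar> \<le> \<bar>int r - int r'\<bar>" for r r' s s'
    proof -
      obtain p where p: "downward_path l p" "p r = s" "p r' = s'"
        by (rule downward_path_through[OF h(1,2,3,4,8)])
      have "(\<Sum>k\<in>{r, r'}. entry l \<nu> k (p k)) \<le> (\<Sum>k = 1..2 * l. entry l \<nu> k (p k))"
        using h by (intro sum_mono2) auto
      also have "\<dots> \<le> 1" using adm p by (simp add: admissible_def)
      finally show ?thesis using p h by simp
    qed
    have "count \<nu> (s, r) \<le> 1" for s r
    proof (cases "(s, r) \<in># \<nu>")
      case True
      note q = row[OF this] and e = entry[OF this]
      obtain p where p: "downward_path l p" "p r = int s" "p r = int s"
        by (rule downward_path_through[of "int s" "int s" r r l]) (use q in auto)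
      have "entry l \<nu> r (p r) \<le> (\<Sum>k = 1..2 * l. entry l \<nu> k (p k))"
        using q by (intro member_le_sum) auto
      also have "\<dots> \<le> 1" using adm p by (simp add: admissible_def)
      finally show ?thesis using p e by simp
    qed (simp add: not_in_iff)
    then have ?C by auto
    moreover have "2 * l < r + s" if sr: "(s, r) \<in># \<nu>" for s r
    proof (rule ccontr)
      assume "\<not> 2 * l < r + s"
      \<comment> \<open>The rows differ: \<open>r = 2 * l\<close> with \<open>s > 0\<close> would
        contradict the assumption.\<close>
      then have "entry l \<nu> r (int s) + entry l \<nu> (2 * l) 0 \<le> 1"
        using row[OF sr] by (intro two) auto
      moreover have "entry l \<nu> (2 * l) 0 = 1" by (simp add: entry_def)
      moreover have "count \<nu> (s, r) > 0" using sr by auto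
      ultimately show False using entry[OF sr] by linarith
    qed
    then have ?E by blast
    moreover have "\<bar>int r - int r'\<bar> < \<bar>int s - int s'\<bar>"
      if sr: "(s, r) \<in># \<nu>" "(s', r') \<in># \<nu>" "r \<noteq> r'" for s r s' r'
    proof (rule ccontr)
      assume "\<not> \<bar>int r - int r'\<bar> < \<bar>int s - int s'\<bar>"
      then have "entry l \<nu> r (int s) + entry l \<nu> r' (int s') \<le> 1"
        using row[OF sr(1)] row[OF sr(2)] sr(3) by (intro two) auto
      moreover have "count \<nu> (s, r) > 0" "count \<nu> (s', r') > 0" using sr by auto
      ultimately show False using entry[OF sr(1)] entry[OF sr(2)] by linarith
    qed
    then have ?P by blast
    ultimately show "?R \<and> ?C \<and> ?E \<and> ?P" using R by blast
  next
    assume A: "?R \<and> ?C \<and> ?E \<and> ?P"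
    have C: "count \<nu> x \<le> 1" for x using A by blast
    have E: "2 * l < r + s" if "(s, r) \<in># \<nu>" for s r using A that by blast
    have P: "\<bar>int r - int r'\<bar> < \<bar>int s - int s'\<bar>"
      if "(s, r) \<in># \<nu>" "(s', r') \<in># \<nu>" "r \<noteq> r'" for s r s' r'
    proof -
      note A[THEN conjunct2, THEN conjunct2, THEN conjunct2]
      from bspec[OF bspec[OF this that(1), unfolded case_prod_conv] that(2)] that(3)
      show ?thesis by simp
    qed
    have "(\<Sum>r = 1..2 * l. entry l \<nu> r (p r)) \<le> 1" if p: "downward_path l p" for p
    proof -
      have one: "entry l \<nu> r s \<le> 1" for r s using C by (simp add: entry_def)
      have "entry l \<nu> r (p r) = 0 \<or> entry l \<nu> r' (p r') = 0"
        if r: "1 \<le> r" "r < r'" "r' \<le> 2 * l" for r r'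
      proof (rule ccontr)
        assume nz: "\<not> (entry l \<nu> r (p r) = 0 \<or> entry l \<nu> r' (p r') = 0)"
        have d: "\<bar>p r' - p r\<bar> \<le> int r' - int r" using downward_path_dist[OF p, of r r'] r by simp
        \<comment> \<open>As \<open>r < r' \<le> 2 * l\<close>, only row \<open>r'\<close> can
          contribute the extra entry 1.\<close>
        have pr: "p r > 0" "(nat (p r), r) \<in># \<nu>"
          using nz r by (auto simp: entry_def split: if_splits)
        consider "p r' > 0" "(nat (p r'), r') \<in># \<nu>" | "p r' = 0" "r' = 2 * l"
          using nz by (auto simp: entry_def split: if_splits)
        then show False
        proof cases
          case 1
          then show False using P[OF pr(2) 1(2)] pr(1) d r by simp
        next
          case 2
          then show False using E[OF pr(2)] pr(1) d r by linarith
        qed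
      qed
      then have unique: "r = r'"
        if "r \<in> {1..2 * l}" "r' \<in> {1..2 * l}" "entry l \<nu> r (p r) \<noteq> 0" "entry l \<nu> r' (p r') \<noteq> 0" for r r'
        using that by (metis atLeastAtMost_iff linorder_cases)
      show ?thesis
      proof (cases "\<forall>r\<in>{1..2 * l}. entry l \<nu> r (p r) = 0")
        case False
        then obtain r where r: "r \<in> {1..2 * l}" "entry l \<nu> r (p r) \<noteq> 0" by blast
        have "entry l \<nu> k (p k) = 0" if "k \<in> {1..2 * l} - {r}" for k
          using unique[of k r] that r by blast
        then have "(\<Sum>r = 1..2 * l. entry l \<nu> r (p r)) = (\<Sum>r\<in>{r}. entry l \<nu> r (p r))"
          using r(1) by (intro sum.mono_neutral_right ballI) simp_all
        then show ?thesis using one by simp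
      qed simp
    qed
    then show "admissible l \<nu>" using R by (simp add: admissible_def)
  qed
qed (simp add: admissible_def)

lemma admissibleD:
  assumes "admissible l \<nu>"
  shows "count \<nu> x \<le> 1"
    and "(s, r) \<in># \<nu> \<Longrightarrow> r \<in> {1..2 * l} \<and> s > 0 \<and> (even s \<longleftrightarrow> even r) \<and> 2 * l < r + s"
    and "(s, r) \<in># \<nu> \<Longrightarrow> (s', r') \<in># \<nu> \<Longrightarrow> r \<noteq> r' \<Longrightarrow>
      \<bar>int r - int r'\<bar> < \<bar>int s - int s'\<bar>"
proof -
  note A = assms[unfolded admissible_iff is_row_partition_def]
  show "count \<nu> x \<le> 1" by (rule spec[OF A[THEN conjunct2, THEN conjunct1]])
  show "r \<in> {1..2 * l} \<and> s > 0 \<and> (even s \<longleftrightarrow> even r) \<and> 2 * l < r + s" if "(s, r) \<in># \<nu>"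
    using bspec[OF A[THEN conjunct1] that]
      bspec[OF A[THEN conjunct2, THEN conjunct2, THEN conjunct1] that] by simp
  show "\<bar>int r - int r'\<bar> < \<bar>int s - int s'\<bar>"
    if "(s, r) \<in># \<nu>" "(s', r') \<in># \<nu>" "r \<noteq> r'"
    using bspec[OF bspec[OF A[THEN conjunct2, THEN conjunct2, THEN conjunct2] that(1),
      unfolded case_prod_conv] that(2)] that(3) by simp
qed

section \<open>Marked paths as pairs of a partition and an admissible partition\<close>

lemma is_partition_rev_sorted_list_of_multiset:
  "is_partition (rev (sorted_list_of_multiset m)) \<longleftrightarrow> 0 \<notin># m"
  by (auto simp: is_partition_def sorted_wrt_rev intro: gr0I)

lemma rev_sorted_list_of_multiset_mset:
  assumes "is_partition xs"
  shows "rev (sorted_list_of_multiset (mset xs)) = xs"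
proof -
  have "sort xs = rev xs"
    using assms by (intro properties_for_sort) (auto simp: is_partition_def sorted_wrt_rev)
  then show ?thesis by simp
qed

text \<open>Lets one copy of each corner be removed from the marks and added back without
  loss.\<close>

lemma mset_set_subset_mset:
  assumes "A \<subseteq> set_mset m"
  shows "mset_set A \<subseteq># m"
  using subset_imp_msubset_mset_set[OF assms] mset_set_set_mset_msubset[of m]
  by (auto intro: subset_mset.order_trans)

text \<open>The corners become the parts of \<open>\<nu>\<close>, and the marks left after removing
  one copy of each corner form \<open>\<mu>\<close>. Conversely, the lowest path through the points
  given by \<open>\<nu>\<close> has exactly these points as corners.\<close>

lemma S3_approx_marked_paths: "S3 l n \<approx> marked_paths (2 * l + 1) n"
proof -
  let ?D = "2 * l + 1"
  \<comment> \<open>The row \<open>r\<close> solves \<open>(i + r) / 2 - l = b i\<close>. It is at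
    least 1 exactly if there is room for the flip, and at most \<open>2 * l\<close> exactly if the
    point respects the diagonal.\<close>
  define f where "f b i = (i, 2 * l + 2 * b i - i)" for b :: "nat \<Rightarrow> nat" and i
  define g where "g = (\<lambda>(b, m). (rev (sorted_list_of_multiset (m - mset_set (corners ?D b))),
    image_mset (f b) (mset_set (corners ?D b))))"
  have inj_f: "inj_on (f b) A" for b A by (auto simp: f_def intro: inj_onI)
  have "bij_betw g (marked_paths ?D n) (S3 l n)"
    unfolding bij_betw_def
  proof (intro conjI antisym subsetI)
    show "inj_on g (marked_paths ?D n)"
    proof (rule inj_onI)
      fix x y assume xy: "x \<in> marked_paths ?D n" "y \<in> marked_paths ?D n" "g x = g y"
      obtain b m c m' where eq: "x = (b, m)" "y = (c, m')" by fastforce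
      have P: "strip_path ?D b" "strip_path ?D c" "corners ?D b \<subseteq> set_mset m" "corners ?D c \<subseteq> set_mset m'"
        using xy eq by (auto simp: marked_paths_def)
      have fin: "finite (corners ?D b)" "finite (corners ?D c)"
        using P(3,4) finite_subset finite_set_mset by blast+
      have nu: "image_mset (f b) (mset_set (corners ?D b)) = image_mset (f c) (mset_set (corners ?D c))"
        using xy(3) eq by (simp add: g_def)
      then have set: "f b ` corners ?D b = f c ` corners ?D c"
        using fin by (metis finite_set_mset_mset_set set_image_mset)
      have "fst ` f b ` corners ?D b = corners ?D b" "fst ` f c ` corners ?D c = corners ?D c"
        by (simp_all add: f_def image_image)
      then have K: "corners ?D c = corners ?D b" using set by simp
      have "b i = c i" if i: "i \<in> corners ?D b" for i
      proof -
        have "f b i \<in> f c ` corners ?D c" using i set by blast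
        then have "2 * l + 2 * b i - i = 2 * l + 2 * c i - i" by (auto simp: f_def)
        moreover have "i + 2 \<le> 2 * b i + ?D" "i + 2 \<le> 2 * c i + ?D"
          using i K by (auto simp: corners_def)
        ultimately show ?thesis by linarith
      qed
      then have bc: "b = c" using strip_path_eq_if_agree[OF P(1,2)] K by blast
      have "mset (rev (sorted_list_of_multiset (m - mset_set (corners ?D b)))) =
            mset (rev (sorted_list_of_multiset (m' - mset_set (corners ?D b))))"
        using xy(3) eq bc by (simp add: g_def)
      then have "m - mset_set (corners ?D b) = m' - mset_set (corners ?D b)" by simp
      moreover have "mset_set (corners ?D b) \<subseteq># m" "mset_set (corners ?D b) \<subseteq># m'"
        using P(3,4) K by (auto intro!: mset_set_subset_mset)
      ultimately have "m = m'" by (metis subset_mset.diff_add)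
      then show "x = y" using bc eq by simp
    qed
  next
    fix x assume "x \<in> g ` marked_paths ?D n"
    then obtain b m where x: "x = g (b, m)" and b: "strip_path ?D b" and m: "0 \<notin># m"
      "corners ?D b \<subseteq> set_mset m" "sum_mset m = n"
      by (auto simp: marked_paths_def)
    let ?K = "corners ?D b"
    define \<nu> where "\<nu> = image_mset (f b) (mset_set ?K)"
    have fin: "finite ?K" using m(2) finite_subset finite_set_mset by blast
    have sub: "mset_set ?K \<subseteq># m" using m(2) by (auto intro!: mset_set_subset_mset)
    have K: "i > 0" "1 \<le> b i" "i + 2 \<le> 2 * b i + ?D" "2 * b i \<le> i" if "i \<in> ?K" for i
      using that strip_pathD(3)[OF b, of i] by (auto simp: corners_def intro: gr0I)
    have set_nu: "set_mset \<nu> = f b ` ?K" using fin by (simp add: \<nu>_def)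
    have nuD: "s \<in> ?K" "r + s = 2 * l + 2 * b s" "1 \<le> r" if "(s, r) \<in># \<nu>" for s r
    proof -
      show s: "s \<in> ?K" using that by (auto simp: set_nu f_def)
      have r: "r = 2 * l + 2 * b s - s" using that by (auto simp: set_nu f_def)
      show "r + s = 2 * l + 2 * b s" "1 \<le> r" using K[OF s] r by linarith+
    qed
    have "is_row_partition l \<nu>"
      unfolding is_row_partition_def
    proof clarify
      fix s r assume "(s, r) \<in># \<nu>"
      note q = nuD[OF this] and k = K[OF nuD(1)[OF this]]
      have "even (r + s)" using q(2) by simp
      then have "even s \<longleftrightarrow> even r" by auto
      then show "r \<in> {1..2 * l} \<and> s > 0 \<and> (even s \<longleftrightarrow> even r)"
        using q k by auto
    qed
    moreover have "count \<nu> p \<le> 1" for p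
      by (simp add: \<nu>_def image_mset_mset_set[OF inj_f] count_mset_set')
    moreover have "2 * l < r + s" if "(s, r) \<in># \<nu>" for s r
      using nuD[OF that] K[OF nuD(1)[OF that]] by linarith
    moreover have "\<bar>int r - int r'\<bar> < \<bar>int s - int s'\<bar>"
      if "(s, r) \<in># \<nu>" "(s', r') \<in># \<nu>" "r \<noteq> r'" for s r s' r'
    proof -
      note q = nuD[OF that(1)] nuD[OF that(2)]
      \<comment> \<open>The row is a function of the size, so different rows mean different sizes.
        For \<open>s < s'\<close> the rows differ by \<open>2 * (b s' - b s) - (s' - s)\<close>,
        with \<open>b s' - b s\<close> strictly between 0 and \<open>s' - s\<close>.\<close>
      have "s < s' \<or> s' < s" using q that(3) by (cases s s' rule: linorder_cases) auto
      then show ?thesis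
        using corners_less[OF b q(1,4)] corners_less[OF b q(4,1)] q by linarith
    qed
    ultimately have "admissible l \<nu>" unfolding admissible_iff by blast
    moreover have "is_partition (rev (sorted_list_of_multiset (m - mset_set ?K)))"
      using m(1) by (simp add: is_partition_rev_sorted_list_of_multiset) (meson in_diffD)
    moreover have "colored_weight \<nu> = sum_mset (mset_set ?K)"
      by (simp add: colored_weight_def \<nu>_def f_def image_mset.compositionality comp_def)
    moreover have "sum_list (rev (sorted_list_of_multiset (m - mset_set ?K))) =
        sum_mset (m - mset_set ?K)"
      by (metis sum_mset_sum_list mset_rev mset_sorted_list_of_multiset)
    moreover have "sum_mset (m - mset_set ?K) + sum_mset (mset_set ?K) = n"
      using sub m(3) by (metis subset_mset.diff_add sum_mset.union)
    ultimately show "x \<in> S3 l n" by (simp add: x g_def S3_def \<nu>_def)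
  next
    fix x assume "x \<in> S3 l n"
    then obtain \<mu> \<nu> where x: "x = (\<mu>, \<nu>)" and mu: "is_partition \<mu>" and adm: "admissible l \<nu>"
      and n: "sum_list \<mu> + colored_weight \<nu> = n"
      by (auto simp: S3_def)
    define M where "M = (\<lambda>(s, r). (s, (r + s - 2 * l) div 2)) ` set_mset \<nu>"
    define b where "b = lowest_path ?D M"
    define m where "m = mset \<mu> + mset_set (corners ?D b)"
    note nu1 = admissibleD(1)[OF adm] and far = admissibleD(3)[OF adm]
    have row: "1 \<le> r" "r \<le> 2 * l" "s > 0" "even s \<longleftrightarrow> even r" "2 * l < r + s" if "(s, r) \<in># \<nu>" for s r
      using admissibleD(2)[OF adm that] by auto
    \<comment> \<open>The halving in \<open>M\<close> is exact and its subtraction does not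
      truncate, as \<open>r + s\<close> is even and exceeds \<open>2 * l\<close>.\<close>
    have ME: "\<exists>r. (s, r) \<in># \<nu> \<and> r + s = 2 * c + 2 * l" if sc: "(s, c) \<in> M" for s c
    proof -
      obtain r where r: "(s, r) \<in># \<nu>" "c = (r + s - 2 * l) div 2" using sc by (auto simp: M_def)
      have "even (r + s)" using row(4)[OF r(1)] by simp
      then show ?thesis using r row(5)[OF r(1)] by auto
    qed
    have flip: "1 \<le> c \<and> i + 2 \<le> 2 * c + ?D" if ic: "(i, c) \<in> M" for i c
    proof -
      obtain r where r: "(i, r) \<in># \<nu>" "r + i = 2 * c + 2 * l" using ME[OF ic] by blast
      show ?thesis using row[OF r(1)] r(2) by linarith
    qed
    have strict: "c < d \<and> d + i < c + j" if ij: "(i, c) \<in> M" "(j, d) \<in> M" "i < j" for i c j d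
    proof -
      obtain r where r: "(i, r) \<in># \<nu>" "r + i = 2 * c + 2 * l" using ME[OF ij(1)] by blast
      obtain r' where r': "(j, r') \<in># \<nu>" "r' + j = 2 * d + 2 * l" using ME[OF ij(2)] by blast
      \<comment> \<open>In a common row, where \<open>far\<close> says nothing,
        \<open>j - i = 2 * (d - c)\<close> gives both inequalities.\<close>
      show ?thesis
        using far[OF r(1) r'(1)] r(2) r'(2) ij(3) by (cases "r = r'") linarith+
    qed
    have M: "strip_chain ?D M"
      unfolding strip_chain_def
    proof (intro conjI)
      show "finite M" by (simp add: M_def)
      show "\<forall>(i, c)\<in>M. 2 * c \<le> i \<and> i \<le> 2 * c + ?D"
      proof clarify
        fix i c assume ic: "(i, c) \<in> M"
        then obtain r where r: "(i, r) \<in># \<nu>" "r + i = 2 * c + 2 * l" using ME by blast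
        show "2 * c \<le> i \<and> i \<le> 2 * c + ?D" using row[OF r(1)] r(2) by linarith
      qed
      show "\<forall>(i, c)\<in>M. \<forall>(j, d)\<in>M. i \<le> j \<longrightarrow> c \<le> d \<and> d + i \<le> c + j"
      proof clarify
        fix i c j d assume *: "(i, c) \<in> M" "(j, d) \<in> M" "i \<le> j"
        show "c \<le> d \<and> d + i \<le> c + j"
        proof (cases "i < j")
          case True
          then show ?thesis using strict[OF *(1,2)] by simp
        next
          case False
          then have "i = j" using *(3) by simp
          then obtain r r' where r: "(i, r) \<in># \<nu>" "r + i = 2 * c + 2 * l"
            "(i, r') \<in># \<nu>" "r' + i = 2 * d + 2 * l"
            using ME *(1,2) by blast
          then have "r = r'" using far by fastforce
          then show ?thesis using r \<open>i = j\<close> by simp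
        qed
      qed
    qed
    have "corners ?D b = fst ` M"
      unfolding b_def by (rule corners_lowest_path_eq[OF M _ flip strict]) auto
    also have "fst ` M = fst ` set_mset \<nu>" by (simp add: M_def image_image case_prod_beta)
    finally have K: "corners ?D b = fst ` set_mset \<nu>" .
    have f_fst: "f b (fst p) = p" if "p \<in># \<nu>" for p
    proof -
      obtain s r where p: "p = (s, r)" by fastforce
      have sr: "(s, r) \<in># \<nu>" using that p by simp
      then have "(s, (r + s - 2 * l) div 2) \<in> M" by (force simp: M_def)
      then have "b s = (r + s - 2 * l) div 2"
        using lowest_path_through[OF M] by (auto simp: b_def passes_through_def)
      moreover have "even (r + s)" using row(4)[OF sr] by simp
      ultimately show ?thesis using row(5)[OF sr] by (auto simp: f_def p elim!: evenE)
    qed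
    have inj: "inj_on fst (set_mset \<nu>)" using f_fst by (metis inj_onI)
    have nu: "mset_set (set_mset \<nu>) = \<nu>"
    proof (rule multiset_eqI)
      fix p
      have "count \<nu> p = 1" if "p \<in># \<nu>"
        using nu1[of p] that by (simp add: le_antisym Suc_le_eq)
      then show "count (mset_set (set_mset \<nu>)) p = count \<nu> p"
        by (simp add: count_mset_set' count_eq_zero_iff)
    qed
    have Kset: "mset_set (corners ?D b) = image_mset fst \<nu>"
      unfolding K image_mset_mset_set[OF inj, symmetric] nu ..
    have "image_mset (f b) (mset_set (corners ?D b)) = image_mset (\<lambda>p. f b (fst p)) \<nu>"
      unfolding Kset by (simp add: image_mset.compositionality comp_def)
    also have "\<dots> = image_mset (\<lambda>p. p) \<nu>" using f_fst by (intro image_mset_cong) auto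
    finally have "g (b, m) = x"
      using rev_sorted_list_of_multiset_mset[OF mu] by (simp add: g_def m_def x)
    moreover have "(b, m) \<in> marked_paths ?D n"
      unfolding marked_paths_def mem_Collect_eq case_prod_conv
    proof (intro conjI)
      show "strip_path ?D b" using strip_path_lowest_path[OF M] by (simp add: b_def)
      have "0 \<notin> fst ` set_mset \<nu>" using row(3) by fastforce
      then show "0 \<notin># m" using mu unfolding m_def Kset by (auto simp: is_partition_def)
      show "corners ?D b \<subseteq> set_mset m" using K unfolding m_def Kset by auto
      show "sum_mset m = n" using n unfolding m_def Kset by (simp add: colored_weight_def sum_mset_sum_list)
    qed
    ultimately show "x \<in> g ` marked_paths ?D n" by (metis imageI)
  qed
  then show ?thesis using eqpoll_def eqpoll_sym by blast
qed

subsection \<open>Cylindric partitions as colored partitions\<close>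

definition conjugate :: "(nat \<Rightarrow> nat) \<Rightarrow> nat \<Rightarrow> nat" where
  "conjugate f t = card {i. t < f i}"

text \<open>The set \<open>{i. t < f i}\<close> is an initial segment, so its size is the first
  index where \<open>f\<close> is at most \<open>t\<close>. The symmetry of the equivalence is what
  makes conjugation an involution.\<close>

lemma less_conjugate_iff:
  assumes f: "antimono f" "finite {i. 0 < f i}"
  shows "i < conjugate f t \<longleftrightarrow> t < f i"
proof -
  have "f (Suc (Max {i. 0 < f i})) = 0"
  proof (rule ccontr)
    assume "f (Suc (Max {i. 0 < f i})) \<noteq> 0"
    then have "Suc (Max {i. 0 < f i}) \<le> Max {i. 0 < f i}" using f(2) by (intro Max_ge) auto
    then show False by simp
  qed
  then have "\<exists>k. f k \<le> t" by (metis zero_le)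
  then have k: "f (LEAST k. f k \<le> t) \<le> t" by (rule LeastI_ex)
  have "{i. t < f i} = {..<LEAST k. f k \<le> t}"
  proof (intro antisym subsetI)
    fix i assume "i \<in> {i. t < f i}"
    then show "i \<in> {..<LEAST k. f k \<le> t}"
      using k antimonoD[OF f(1), of "LEAST k. f k \<le> t" i] by (auto simp: not_less[symmetric])
  next
    fix i assume "i \<in> {..<LEAST k. f k \<le> t}"
    then show "i \<in> {i. t < f i}" using not_less_Least[of i "\<lambda>k. f k \<le> t"] by (auto simp: not_le)
  qed
  then show ?thesis unfolding conjugate_def by (metis card_lessThan lessThan_iff mem_Collect_eq)
qed

lemma eq_if_less_iff: "(\<And>k. k < m \<longleftrightarrow> k < n) \<Longrightarrow> m = n" for m n :: nat
  by (metis less_irrefl linorder_less_linear)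

lemma antimono_conjugate:
  assumes "antimono f" "finite {i. 0 < f i}"
  shows "antimono (conjugate f)"
proof (rule antimonoI)
  fix s t :: nat assume "s \<le> t"
  then show "conjugate f t \<le> conjugate f s"
    unfolding conjugate_def by (intro card_mono finite_subset[OF _ assms(2)]) auto
qed

lemma finite_support_conjugate:
  assumes "antimono f" "finite {i. 0 < f i}"
  shows "finite {t. 0 < conjugate f t}"
  unfolding less_conjugate_iff[OF assms] by simp

lemma conjugate_conjugate:
  assumes "antimono f" "finite {i. 0 < f i}"
  shows "conjugate (conjugate f) = f"
  by (intro ext eq_if_less_iff)
    (simp add: less_conjugate_iff antimono_conjugate finite_support_conjugate assms)

text \<open>By \<open>less_conjugate_iff\<close> it suffices to test \<open>t = g i\<close> in one
  direction and \<open>i = conjugate g t\<close> in the other. This turns shifted comparisons of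
  rows into bounds between columns.\<close>

lemma conjugate_le_shift_iff:
  assumes f: "antimono f" "finite {i. 0 < f i}" and g: "antimono g" "finite {i. 0 < g i}"
  shows "(\<forall>t. conjugate f t \<le> conjugate g t + c) \<longleftrightarrow> (\<forall>i. f (i + c) \<le> g i)"
proof (intro iffI allI)
  fix i assume *: "\<forall>t. conjugate f t \<le> conjugate g t + c"
  have "\<not> i + c < conjugate f (g i)"
    using *[rule_format, of "g i"] less_conjugate_iff[OF g, of i "g i"] by linarith
  then show "f (i + c) \<le> g i" by (simp add: less_conjugate_iff[OF f])
next
  fix t assume *: "\<forall>i. f (i + c) \<le> g i"
  have "\<not> t < f (conjugate g t + c)"
    using *[rule_format, of "conjugate g t"] less_conjugate_iff[OF g, of "conjugate g t" t]
    by linarith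
  then show "conjugate f t \<le> conjugate g t + c" by (simp add: less_conjugate_iff[OF f, symmetric])
qed

section \<open>Partitions as nonincreasing functions indexed from 0\<close>

definition row :: "nat list \<Rightarrow> nat \<Rightarrow> nat" where
  "row xs i = part xs (Suc i)"

lemma row_eq: "row xs i = (if i < length xs then xs ! i else 0)"
  by (simp add: row_def part_def)

lemma row_partition:
  assumes "is_partition xs"
  shows "antimono (row xs)" "finite {i. 0 < row xs i}" "0 < row xs i \<longleftrightarrow> i < length xs"
proof -
  show pos: "0 < row xs i \<longleftrightarrow> i < length xs" for i
    using assms by (auto simp: row_eq is_partition_def)
  show "antimono (row xs)"
  proof (rule antimonoI)
    fix i j :: nat assume "i \<le> j"
    then show "row xs j \<le> row xs i"
      using assms sorted_wrt_nth_less[of "(\<ge>)" xs i j]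
      by (cases "i = j") (auto simp: row_eq is_partition_def)
  qed
  show "finite {i. 0 < row xs i}" unfolding pos by simp
qed

lemma row_inject:
  assumes "is_partition xs" "is_partition ys" "row xs = row ys"
  shows "xs = ys"
proof (rule nth_equalityI)
  show "length xs = length ys"
    using row_partition(3)[OF assms(1)] row_partition(3)[OF assms(2)] assms(3)
    by (intro eq_if_less_iff) simp
  then show "xs ! i = ys ! i" if "i < length xs" for i
    using fun_cong[OF assms(3), of i] that by (simp add: row_eq)
qed

lemma row_surj:
  assumes "antimono f" "finite {i. 0 < f i}"
  obtains xs where "is_partition xs" "row xs = f"
proof -
  define xs where "xs = map f [0..<conjugate f 0]"
  have pos: "i < conjugate f 0 \<longleftrightarrow> 0 < f i" for i by (rule less_conjugate_iff[OF assms])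
  have "is_partition xs"
    unfolding is_partition_def
  proof
    show "sorted_wrt (\<ge>) xs"
      using assms(1) by (auto simp: xs_def sorted_wrt_iff_nth_less intro: antimonoD)
    show "\<forall>x\<in>set xs. 0 < x" by (auto simp: xs_def pos[symmetric])
  qed
  moreover have "row xs = f" using pos by (auto simp: xs_def row_eq fun_eq_iff)
  ultimately show thesis using that by blast
qed

text \<open>Counts the cells of the Young diagram by columns. Allowing any bound \<open>N\<close> on
  the parts lets both components of a cylindric partition be summed over one range.\<close>

lemma sum_conjugate_row:
  assumes "is_partition xs" "row xs 0 \<le> N"
  shows "(\<Sum>t<N. conjugate (row xs) t) = sum_list xs"
proof -
  have le: "row xs i \<le> N" for i
    using antimonoD[OF row_partition(1)[OF assms(1)], of 0 i] assms(2) by simp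
  have "conjugate (row xs) t = (\<Sum>i<length xs. if t < row xs i then 1 else 0)" for t
  proof -
    have "{i. t < row xs i} = {i \<in> {..<length xs}. t < row xs i}"
      using row_partition(3)[OF assms(1)] by (auto dest: gr_implies_not0)
    then show ?thesis by (simp add: conjugate_def sum.If_cases Int_def)
  qed
  then have "(\<Sum>t<N. conjugate (row xs) t) =
      (\<Sum>i<length xs. \<Sum>t<N. if t < row xs i then 1 else 0)"
    by (simp only:) (rule sum.swap)
  also have "\<dots> = (\<Sum>i<length xs. row xs i)"
  proof (rule sum.cong)
    fix i
    have "{..<N} \<inter> {t. t < row xs i} = {..<row xs i}" using le[of i] by auto
    then show "(\<Sum>t<N. if t < row xs i then 1 else 0) = row xs i" by (simp add: sum.If_cases)
  qed simp
  also have "\<dots> = sum_list xs"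
    by (simp add: sum_list_sum_nth atLeast0LessThan row_eq)
  finally show ?thesis .
qed

text \<open>Conjugation moves the offsets 0 and \<open>c\<close> from the rows to the columns, so
  the condition becomes that every layer lies in the strip of width \<open>c\<close>.\<close>

lemma is_cylindric_iff:
  "is_cylindric c 0 (xs, ys) \<longleftrightarrow> is_partition xs \<and> is_partition ys \<and>
     (\<forall>t. conjugate (row ys) t \<le> conjugate (row xs) t) \<and>
     (\<forall>t. conjugate (row xs) t \<le> conjugate (row ys) t + c)"
proof (cases "is_partition xs \<and> is_partition ys")
  case True
  note x = row_partition(1,2)[OF conjunct1[OF True]]
    and y = row_partition(1,2)[OF conjunct2[OF True]]
  have shift: "(\<forall>i\<ge>1. P i) \<longleftrightarrow> (\<forall>i. P (Suc i))" for P
    by (simp add: Suc_le_eq gr0_conv_Suc) blast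
  show ?thesis
    using True conjugate_le_shift_iff[OF y x, of 0] conjugate_le_shift_iff[OF x y, of c]
    unfolding is_cylindric_def shift row_def by simp
qed (auto simp: is_cylindric_def)

section \<open>Encoding layers as colored parts\<close>

lemma size_filter_image_lessThan:
  "size (filter_mset P (image_mset f (mset_set {..<N}))) = card {t. t < N \<and> P (f t)}" for N :: nat
  by (simp add: filter_mset_image_mset)

lemma half_sum_minus_le: "(a + b) div 2 - b \<le> l" if "a \<le> b + (2 * l + 1)" for a b l :: nat
  using that by linarith

text \<open>Each nonempty layer is encoded as one colored part. The inverse sorts the parts by
  decreasing size, decodes them into layers and conjugates.\<close>

lemma S1_approx_S2: "S1 l n \<approx> S2 l n"
proof -
  define pt where "pt a b = (a + b, (a + b) div 2 - b)" for a b :: nat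
  have pt: "(fst (pt a b) + 1) div 2 + snd (pt a b) = a" "fst (pt a b) div 2 - snd (pt a b) = b"
    if "b \<le> a" for a b
    using that unfolding pt_def fst_conv snd_conv by linarith+
  \<comment> \<open>Layer \<open>t\<close> is nonempty precisely for \<open>t < row xs 0\<close>,
    since its second coordinate is at most its first.\<close>
  define F where "F = (\<lambda>(xs, ys). image_mset
    (\<lambda>t. pt (conjugate (row xs) t) (conjugate (row ys) t)) (mset_set {..<row xs 0}))"
  have cyl: "is_partition xs" "is_partition ys" "conjugate (row ys) t \<le> conjugate (row xs) t"
    "conjugate (row xs) t \<le> conjugate (row ys) t + (2 * l + 1)"
    "sum_list xs + sum_list ys = n" if "(xs, ys) \<in> S1 l n" for xs ys t
    using that by (auto simp: S1_def is_cylindric_iff)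
  \<comment> \<open>By conjugation, a row entry with index \<open>i\<close> counts the layers whose
    coordinate exceeds \<open>i\<close>. The count depends on the value of \<open>F\<close> alone,
    so \<open>F\<close> is injective.\<close>
  have rows: "row xs i = size (filter_mset (\<lambda>(s, A). i < (s + 1) div 2 + A) (F (xs, ys)))"
    "row ys i = size (filter_mset (\<lambda>(s, A). i < s div 2 - A) (F (xs, ys)))"
    if S1: "(xs, ys) \<in> S1 l n" for xs ys i
  proof -
    note c = cyl[OF S1]
    note lx = less_conjugate_iff[OF row_partition(1,2)[OF c(1)]]
      and ly = less_conjugate_iff[OF row_partition(1,2)[OF c(2)]]
    have le: "row xs i \<le> row xs 0" using antimonoD[OF row_partition(1)[OF c(1)]] by simp
    have "\<not> row xs i < row ys i"
      using c(3)[of "row xs i"] lx[of i "row xs i"] ly[of i "row xs i"] by linarith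
    then have le': "row ys i \<le> row xs 0" using le by simp
    have "row xs i = card {t. t < row xs 0 \<and> i < conjugate (row xs) t}"
    proof -
      have "{t. t < row xs 0 \<and> i < conjugate (row xs) t} = {..<row xs i}" using le lx by auto
      then show ?thesis by simp
    qed
    then show "row xs i = size (filter_mset (\<lambda>(s, A). i < (s + 1) div 2 + A) (F (xs, ys)))"
      unfolding F_def
      by (simp only: fst_conv snd_conv case_prod_conv case_prod_beta
          size_filter_image_lessThan pt[OF c(3)])
    have "row ys i = card {t. t < row xs 0 \<and> i < conjugate (row ys) t}"
    proof -
      have "{t. t < row xs 0 \<and> i < conjugate (row ys) t} = {..<row ys i}" using le' ly by auto
      then show ?thesis by simp
    qed
    then show "row ys i = size (filter_mset (\<lambda>(s, A). i < s div 2 - A) (F (xs, ys)))"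
      unfolding F_def
      by (simp only: fst_conv snd_conv case_prod_conv case_prod_beta
          size_filter_image_lessThan pt[OF c(3)])
  qed
  have "bij_betw F (S1 l n) (S2 l n)"
    unfolding bij_betw_def
  proof (intro conjI antisym subsetI)
    show "inj_on F (S1 l n)"
    proof (rule inj_onI)
      fix \<tau> \<sigma> assume *: "\<tau> \<in> S1 l n" "\<sigma> \<in> S1 l n" "F \<tau> = F \<sigma>"
      obtain xs ys us vs where eq: "\<tau> = (xs, ys)" "\<sigma> = (us, vs)" by fastforce
      have S1: "(xs, ys) \<in> S1 l n" "(us, vs) \<in> S1 l n" and F: "F (xs, ys) = F (us, vs)"
        using * eq by auto
      have "row xs = row us" "row ys = row vs"
        using rows[OF S1(1)] rows[OF S1(2)] F by (auto simp: fun_eq_iff)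
      then show "\<tau> = \<sigma>" using row_inject cyl(1,2)[OF S1(1)] cyl(1,2)[OF S1(2)] eq by blast
    qed
  next
    fix \<Lambda> assume "\<Lambda> \<in> F ` S1 l n"
    then obtain xs ys where \<Lambda>: "\<Lambda> = F (xs, ys)" and S1: "(xs, ys) \<in> S1 l n" by auto
    note c = cyl[OF S1]
    define a b where "a = conjugate (row xs)" and "b = conjugate (row ys)"
    have ab: "b t \<le> a t" "a t \<le> b t + (2 * l + 1)" for t using c(3,4) by (auto simp: a_def b_def)
    have mono: "a u \<le> a t" "b u \<le> b t" if "t \<le> u" for t u
      using that antimonoD[OF antimono_conjugate[OF row_partition(1,2)[OF c(1)]]]
        antimonoD[OF antimono_conjugate[OF row_partition(1,2)[OF c(2)]]]
      by (auto simp: a_def b_def)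
    have mem: "\<exists>t<row xs 0. i = a t + b t \<and> A = i div 2 - b t" if "(i, A) \<in># \<Lambda>" for i A
      using that by (auto simp: \<Lambda> F_def pt_def a_def b_def)
    have "row ys 0 \<le> row xs 0"
      using ab(1)[of "row xs 0"] less_conjugate_iff[OF row_partition(1,2)[OF c(1)], of 0 "row xs 0"]
        less_conjugate_iff[OF row_partition(1,2)[OF c(2)], of 0 "row xs 0"]
      unfolding a_def b_def by linarith
    then have "colored_weight \<Lambda> = n"
      using sum_conjugate_row[OF c(1), of "row xs 0"] sum_conjugate_row[OF c(2), of "row xs 0"] c(5)
      by (simp add: colored_weight_def \<Lambda> F_def pt_def image_mset.compositionality comp_def
          sum.distrib flip: sum_unfold_sum_mset)
    moreover have "i > 0 \<and> A \<le> l \<and> A \<le> i div 2" if iA: "(i, A) \<in># \<Lambda>" for i A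
    proof -
      obtain t where t: "t < row xs 0" "i = a t + b t" "A = i div 2 - b t" using mem[OF iA] by blast
      have "0 < a t" using t(1) less_conjugate_iff[OF row_partition(1,2)[OF c(1)]] by (simp add: a_def)
      then show ?thesis using t half_sum_minus_le[OF ab(2)[of t]] by simp
    qed
    moreover have "i div 2 + B \<le> j div 2 + A \<and> (i + 1) div 2 + A \<le> (j + 1) div 2 + B"
      if iA: "(i, A) \<in># \<Lambda>" "(j, B) \<in># \<Lambda>" "i \<le> j" for i A j B
    proof -
      obtain t where t: "i = a t + b t" "A = i div 2 - b t" using mem[OF iA(1)] by blast
      obtain u where u: "j = a u + b u" "B = j div 2 - b u" using mem[OF iA(2)] by blast
      \<comment> \<open>For \<open>u \<le> t\<close> this is \<open>mono\<close>. For
        \<open>t \<le> u\<close> neither coordinate grows from \<open>t\<close> to \<open>u\<close>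
        while their sum does not drop, so they agree.\<close>
      have le: "a t \<le> a u" "b t \<le> b u"
        using mono[of t u] mono[of u t] t(1) u(1) iA(3) by linarith+
      have "b t \<le> i div 2" "b u \<le> j div 2" using ab(1)[of t] ab(1)[of u] t(1) u(1) by auto
      then show ?thesis using le t u unfolding ceiling_half_nat by linarith
    qed
    ultimately show "\<Lambda> \<in> S2 l n" unfolding S2_iff by blast
  next
    fix \<Lambda> assume "\<Lambda> \<in> S2 l n"
    then have \<Lambda>: "colored_weight \<Lambda> = n"
      "\<And>i A. (i, A) \<in># \<Lambda> \<Longrightarrow> i > 0 \<and> A \<le> l \<and> A \<le> i div 2"
      "\<And>i A j B. (i, A) \<in># \<Lambda> \<Longrightarrow> (j, B) \<in># \<Lambda> \<Longrightarrow> i \<le> j \<Longrightarrow>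
        i div 2 + B \<le> j div 2 + A \<and> (i + 1) div 2 + A \<le> (j + 1) div 2 + B"
      unfolding S2_iff by blast+
    obtain zs' where zs': "mset zs' = \<Lambda>" using ex_mset by blast
    \<comment> \<open>Columns are listed by decreasing weight. Ties are harmless, as parts of equal
      size have the same color.\<close>
    define zs where "zs = rev (sort_key fst zs')"
    define N where "N = length zs"
    have zs: "mset zs = \<Lambda>" by (simp add: zs_def zs')
    \<comment> \<open>The value 0 beyond the last part keeps the coordinates nonincreasing with
      finite support, as conjugation requires.\<close>
    define a where "a t = (if t < N then (fst (zs ! t) + 1) div 2 + snd (zs ! t) else 0)" for t
    define b where "b t = (if t < N then fst (zs ! t) div 2 - snd (zs ! t) else 0)" for t
    have zsin: "(fst (zs ! t), snd (zs ! t)) \<in># \<Lambda>" if "t < N" for t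
      using that nth_mem[of t zs] by (simp add: N_def flip: zs)
    have srt: "fst (zs ! u) \<le> fst (zs ! t)" if "t \<le> u" "u < N" for t u
    proof -
      have "sorted_wrt (\<lambda>x y. fst y \<le> fst x) zs"
        using sorted_sort_key[of fst zs'] by (simp add: zs_def sorted_wrt_rev sorted_map)
      then show ?thesis
        using sorted_wrt_nth_less[of _ zs t u] that by (cases "t = u") (auto simp: N_def)
    qed
    have anti: "a u \<le> a t \<and> b u \<le> b t" if "t \<le> u" for t u
    proof (cases "u < N")
      case True
      then have t: "t < N" using that by simp
      show ?thesis
        using \<Lambda>(3)[OF zsin[OF True] zsin[OF t] srt[OF that True]]
          \<Lambda>(2)[OF zsin[OF t]] \<Lambda>(2)[OF zsin[OF True]] t True
        by (auto simp: a_def b_def)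
    qed (simp add: a_def b_def)
    then have "antimono a" "antimono b" by (auto intro: antimonoI)
    moreover have "finite {t. 0 < a t}" "finite {t. 0 < b t}"
      by (rule finite_subset[of _ "{..<N}"]; auto simp: a_def b_def split: if_splits)+
    ultimately have A: "antimono a" "finite {t. 0 < a t}" and B: "antimono b" "finite {t. 0 < b t}"
      by blast+
    obtain xs where xs: "is_partition xs" "row xs = conjugate a"
      using row_surj[OF antimono_conjugate[OF A] finite_support_conjugate[OF A]] by blast
    obtain ys where ys: "is_partition ys" "row ys = conjugate b"
      using row_surj[OF antimono_conjugate[OF B] finite_support_conjugate[OF B]] by blast
    have conj: "conjugate (row xs) = a" "conjugate (row ys) = b"
      by (simp_all add: xs ys conjugate_conjugate A B)
    have sum: "a t + b t = fst (zs ! t)" "b t \<le> a t" "a t \<le> b t + (2 * l + 1)" "0 < a t"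
      "fst (zs ! t) div 2 - b t = snd (zs ! t)" if "t < N" for t
      using that \<Lambda>(2)[OF zsin[OF that]] unfolding a_def b_def by auto
    \<comment> \<open>Positive sizes give \<open>0 < a t\<close>, so \<open>F\<close> reads off
      exactly the \<open>N\<close> layers put in.\<close>
    have N: "row xs 0 = N"
    proof -
      have "{t. 0 < a t} = {..<N}" using sum(4) by (auto simp: a_def split: if_splits)
      then show ?thesis by (simp add: xs conjugate_def)
    qed
    have cyl': "is_cylindric (2 * l + 1) 0 (xs, ys)"
    proof -
      have "b t \<le> a t \<and> a t \<le> b t + (2 * l + 1)" for t
        using sum(2,3)[of t] by (cases "t < N") (auto simp: a_def b_def)
      then show ?thesis unfolding is_cylindric_iff conj using xs ys by blast
    qed
    have "F (xs, ys) = image_mset (\<lambda>t. zs ! t) (mset_set {..<N})"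
      unfolding F_def by (simp add: conj N) (intro image_mset_cong, simp add: pt_def sum)
    also have "\<dots> = mset (map (\<lambda>t. zs ! t) [0..<N])"
      by (simp add: atLeast0LessThan)
    also have "\<dots> = \<Lambda>" by (simp add: N_def map_nth zs)
    finally have F: "F (xs, ys) = \<Lambda>" .
    have "row ys 0 \<le> N"
    proof -
      have "{t. 0 < b t} \<subseteq> {..<N}" by (auto simp: b_def split: if_splits)
      from card_mono[OF _ this] show ?thesis by (simp add: ys conjugate_def)
    qed
    then have "sum_list xs + sum_list ys = (\<Sum>t<N. a t + b t)"
      using sum_conjugate_row[OF xs(1), of N] sum_conjugate_row[OF ys(1), of N] N conj
      by (simp add: sum.distrib)
    also have "\<dots> = colored_weight (F (xs, ys))"
      by (simp add: colored_weight_def F_def pt_def conj N image_mset.compositionality comp_def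
          flip: sum_unfold_sum_mset)
    finally have "(xs, ys) \<in> S1 l n" using cyl' F \<Lambda>(1) by (simp add: S1_def)
    then show "\<Lambda> \<in> F ` S1 l n" using F by blast
  qed
  then show ?thesis unfolding eqpoll_def by blast
qed

theorem theorem6p2:
  fixes l n :: nat
  assumes "l \<ge> 1"
  shows "S1 l n \<approx> S2 l n \<and> S2 l n \<approx> S3 l n"
  using S1_approx_S2 eqpoll_trans[OF S2_approx_marked_paths eqpoll_sym[OF S3_approx_marked_paths]]
  by blast

end
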